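(* Let $G$ be a graph and partition its vertex set as $V(G) = A_G\cup B_G\cup C_G$, where $A_G=\{v: \deg(v)=\chi(G)-1\}$, $B_G=\{v:\deg(v)>\chi(G)-1\}$ and $C_G=\{v:\deg(v)<\chi(G)-1\}$. Then $G$ is an NG-graph if and only if all of the following hold: (i) $A_G\neq\emptyset$ and $G[A_G]$ is a clique, an independent set, or a 5-cycle; (ii) $G[B_G]$ is a clique; (iii) $G[C_G]$ is an independent set; (iv) $uv\in E(G)$ for all $u\in A_G$, $v\in B_G$; (v) $uw\notin E(G)$ for all $u\in A_G$, $w\in C_G$.
   Context: Graphs are finite and simple. $\overline{G}$ is the complement of $G$, $\chi$ is the chromatic number, and $G[S]$ is the subgraph of $G$ induced by the vertex set $S$. A graph $G$ with $n=|V(G)|$ vertices is an NG-graph if $\chi(G)+\chi(\overline{G})=n+1$. In (ii) and (iii) the sets $B_G$, $C_G$ may be empty (the conditions then hold trivially). *)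

theory Defs
  imports "Graph_Theory.Kuratowski" "Graph_Theory.Digraph_Isomorphism"
begin

text \<open>
  A finite simple graph is a \<^term>\<open>pair_graph\<close>: finitely many vertices, and an irreflexive symmetric
  set of arcs in which an edge \<open>uv\<close> is represented by both pairs \<open>(u, v)\<close> and \<open>(v, u)\<close>.  Hence the
  degree of a vertex is its out-degree.
\<close>

definition degree :: "'a pair_pre_digraph \<Rightarrow> 'a \<Rightarrow> nat" where
  "degree G v = out_degree (with_proj G) v"

definition complement :: "'a pair_pre_digraph \<Rightarrow> 'a pair_pre_digraph" where
  "complement G = \<lparr> pverts = pverts G,
     parcs = {(u, v). u \<in> pverts G \<and> v \<in> pverts G \<and> u \<noteq> v \<and> (u, v) \<notin> parcs G} \<rparr>"

definition proper_colouring :: "'a pair_pre_digraph \<Rightarrow> nat \<Rightarrow> ('a \<Rightarrow> nat) \<Rightarrow> bool" where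
  "proper_colouring G k c \<longleftrightarrow>
     (\<forall>v \<in> pverts G. c v < k) \<and> (\<forall>(u, v) \<in> parcs G. c u \<noteq> c v)"

definition chromatic_number :: "'a pair_pre_digraph \<Rightarrow> nat" where
  "chromatic_number G = (LEAST k. \<exists>c. proper_colouring G k c)"

definition NG_graph :: "'a pair_pre_digraph \<Rightarrow> bool" where
  "NG_graph G \<longleftrightarrow>
     chromatic_number G + chromatic_number (complement G) = card (pverts G) + 1"

text \<open>The predicates for cliques, independent sets and 5-cycles apply to the induced subgraph.
  The graph without vertices is both complete and edgeless.\<close>

definition complete_graph :: "('a, 'b) pre_digraph \<Rightarrow> bool" where
  "complete_graph H \<longleftrightarrow> complete_digraph (card (verts H)) H"

definition edgeless_graph :: "('a, 'b) pre_digraph \<Rightarrow> bool" where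
  "edgeless_graph H \<longleftrightarrow> arcs H = {}"

text \<open>The standard cycle on \<open>0, ..., n - 1\<close>, for \<open>n \<ge> 3\<close>.\<close>

definition cycle_graph :: "nat \<Rightarrow> nat pair_pre_digraph" where
  "cycle_graph n = \<lparr> pverts = {..<n},
     parcs = {(i, j). i < n \<and> j < n \<and> (j = Suc i mod n \<or> i = Suc j mod n)} \<rparr>"

definition is_five_cycle :: "('a, 'b) pre_digraph \<Rightarrow> bool" where
  "is_five_cycle H \<longleftrightarrow> digraph_iso (with_proj (cycle_graph 5)) H"

text \<open>Vertex degrees are compared with \<open>\<chi>(G) - 1\<close> in the integers, avoiding truncated subtraction.\<close>

definition A_set :: "'a pair_pre_digraph \<Rightarrow> 'a set" where
  "A_set G = {v \<in> pverts G. int (degree G v) = int (chromatic_number G) - 1}"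

definition B_set :: "'a pair_pre_digraph \<Rightarrow> 'a set" where
  "B_set G = {v \<in> pverts G. int (degree G v) > int (chromatic_number G) - 1}"

definition C_set :: "'a pair_pre_digraph \<Rightarrow> 'a set" where
  "C_set G = {v \<in> pverts G. int (degree G v) < int (chromatic_number G) - 1}"

end

theory Submission
  imports Defs
begin

text \<open>
  Write \<open>A\<close>, \<open>B\<close>, \<open>C\<close> for the three degree classes of a graph \<open>G\<close> on \<open>n\<close> vertices, and \<open>\<chi>\<close>, \<open>\<chi>'\<close>
  for the chromatic numbers of \<open>G\<close> and of its complement.  In an NG-graph, complementing
  exchanges \<open>B\<close> with \<open>C\<close> and keeps \<open>A\<close>, so every fact proved for \<open>G\<close> has a dual one, obtained by
  applying it to the complement.

  Suppose that \<open>G\<close> is an NG-graph.  Vertices of \<open>C\<close> have degree less than \<open>\<chi> - 1\<close>, so any colouring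
  of \<open>G[A \<union> B]\<close> with at least \<open>\<chi> - 1\<close> colours extends greedily to \<open>C\<close>; hence
  \<open>\<chi> \<le> \<chi>(A) + \<chi>(B) \<le> \<chi>(A) + |B|\<close>, and dually \<open>\<chi>' \<le> \<chi>'(A) + |C|\<close>.  Adding both and using the
  Nordhaus--Gaddum bound \<open>\<chi>(A) + \<chi>'(A) \<le> |A| + 1\<close>, the sum is at most \<open>n + 1\<close>.  As it is equal to
  \<open>n + 1\<close>, all these estimates are equalities: \<open>B\<close> is a clique, \<open>C\<close> is independent, \<open>A\<close> is nonempty
  and \<open>G[A]\<close> is itself an NG-graph (lemma \<open>NG_decomposition\<close>).  A non-edge between \<open>A\<close> and \<open>B\<close>
  would save a colour or violate the degree condition, which gives the joins between the classes
  (\<open>NG_mid_high_joined\<close> and its dual).  It follows that \<open>G[A]\<close> is regular of degree \<open>\<chi>(A) - 1\<close>.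

  It remains to classify regular NG-graphs \<open>H\<close> whose degree is \<open>\<chi>(H) - 1\<close> (\<open>NG_regular\<close>).  Delete a
  vertex \<open>u\<close>.  By the Nordhaus--Gaddum bound, at least one of the two chromatic numbers drops.  If only
  one does, then \<open>H - u\<close> is again an NG-graph, and the structure found above, applied to \<open>H - u\<close>, makes
  \<open>H\<close> complete or edgeless (\<open>clique_if_critical_vertex\<close>).  If both drop, a recolouring argument in the
  style of Kempe (\<open>critical_regular\<close>, \<open>doubly_critical\<close>) shows that \<open>u\<close> has as many neighbours
  as non-neighbours, say \<open>d\<close>, and that the number \<open>d\<close> of edges between the two sets is also
  \<open>d * (d - 1)\<close>; hence \<open>d = 0\<close> or \<open>d = 2\<close>, and \<open>H\<close> is a single vertex or a 5-cycle.

  For the converse, a vertex of \<open>A\<close> determines \<open>\<chi>\<close> by its degree, while \<open>C\<close> is a clique of the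
  complement joined there to all of \<open>A\<close>, so that \<open>\<chi>' \<ge> \<chi>'(A) + |C|\<close>; the sum is then at least
  \<open>n + 1\<close> in each of the three cases for \<open>G[A]\<close>.
\<close>

section \<open>Colourings of a relation on a vertex set\<close>

text \<open>
  Graphs are given by an adjacency relation and a vertex set, so an induced subgraph is the same
  relation on a smaller set.  The inequality keeps complements loopless, which makes \<open>co\<close> an
  involution on irreflexive relations.
\<close>

definition co :: "('a \<Rightarrow> 'a \<Rightarrow> bool) \<Rightarrow> 'a \<Rightarrow> 'a \<Rightarrow> bool" where
  "co E u v \<longleftrightarrow> u \<noteq> v \<and> \<not> E u v"

definition nbrs :: "('a \<Rightarrow> 'a \<Rightarrow> bool) \<Rightarrow> 'a set \<Rightarrow> 'a \<Rightarrow> 'a set" where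
  "nbrs E S v = {w \<in> S. E v w}"

definition colouring :: "('a \<Rightarrow> 'a \<Rightarrow> bool) \<Rightarrow> 'a set \<Rightarrow> nat \<Rightarrow> ('a \<Rightarrow> nat) \<Rightarrow> bool" where
  "colouring E S k c \<longleftrightarrow> (\<forall>v\<in>S. c v < k) \<and> (\<forall>u\<in>S. \<forall>v\<in>S. E u v \<longrightarrow> c u \<noteq> c v)"

definition chi :: "('a \<Rightarrow> 'a \<Rightarrow> bool) \<Rightarrow> 'a set \<Rightarrow> nat" where
  "chi E S = (LEAST k. \<exists>c. colouring E S k c)"

lemma symp_co: "symp E \<Longrightarrow> symp (co E)"
  by (auto simp: symp_def co_def)

lemma irreflp_co: "irreflp (co E)"
  by (auto simp: irreflp_def co_def)

lemma co_co: "irreflp E \<Longrightarrow> co (co E) = E"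
  by (auto simp: co_def fun_eq_iff irreflp_def)

lemma finite_nbrs [simp]: "finite S \<Longrightarrow> finite (nbrs E S v)"
  by (simp add: nbrs_def)

lemma nbrs_subset: "nbrs E S v \<subseteq> S"
  by (auto simp: nbrs_def)

lemma nbrs_mono: "T \<subseteq> S \<Longrightarrow> nbrs E T v \<subseteq> nbrs E S v"
  by (auto simp: nbrs_def)

lemma card_nbrs_co:
  assumes "finite S" "v \<in> S" "irreflp E"
  shows "card (nbrs E S v) + card (nbrs (co E) S v) + 1 = card S"
proof -
  have "S = insert v (nbrs E S v \<union> nbrs (co E) S v)"
    using assms by (auto simp: nbrs_def co_def irreflp_def)
  moreover have "v \<notin> nbrs E S v \<union> nbrs (co E) S v" "nbrs E S v \<inter> nbrs (co E) S v = {}"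
    using assms by (auto simp: nbrs_def co_def irreflp_def)
  ultimately show ?thesis
    using assms(1) by (metis Suc_eq_plus1 card_Un_disjoint card_insert_disjoint finite_UnI finite_nbrs)
qed

lemma chi_le: "colouring E S k c \<Longrightarrow> chi E S \<le> k"
  unfolding chi_def by (rule Least_le) blast

lemma inj_colouring:
  assumes "finite S" "irreflp E"
  obtains c where "colouring E S (card S) c"
proof -
  obtain c where "bij_betw c S {0..<card S}"
    using ex_bij_betw_finite_nat[OF assms(1)] by blast
  then have "colouring E S (card S) c"
    using assms(2) by (fastforce simp: colouring_def bij_betw_def inj_on_def irreflp_def)
  then show thesis by (rule that)
qed

lemma chi_le_card: "finite S \<Longrightarrow> irreflp E \<Longrightarrow> chi E S \<le> card S"
  by (metis inj_colouring chi_le)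

lemma chi_colouring:
  assumes "finite S" "irreflp E"
  obtains c where "colouring E S (chi E S) c"
proof -
  have "\<exists>k c. colouring E S k c"
    using inj_colouring[OF assms] by blast
  then have "\<exists>c. colouring E S (chi E S) c"
    unfolding chi_def by (rule LeastI_ex)
  then show thesis
    using that by blast
qed

lemma colouring_weaken: "colouring E S k c \<Longrightarrow> T \<subseteq> S \<Longrightarrow> k \<le> l \<Longrightarrow> colouring E T l c"
  unfolding colouring_def by (meson order_less_le_trans subsetD)

lemma chi_le_colouring:
  assumes "finite S" "irreflp E" "chi E S \<le> k"
  obtains c where "colouring E S k c"
  using chi_colouring[OF assms(1,2)] colouring_weaken[OF _ subset_refl assms(3)] by metis

lemma chi_mono: "finite S \<Longrightarrow> irreflp E \<Longrightarrow> T \<subseteq> S \<Longrightarrow> chi E T \<le> chi E S"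
  by (meson chi_colouring chi_le colouring_weaken order_refl)

lemma chi_empty [simp]: "chi E {} = 0"
  using chi_le[of E "{}" 0] by (simp add: colouring_def)

lemma chi_pos:
  assumes "finite S" "irreflp E" "S \<noteq> {}"
  shows "0 < chi E S"
proof -
  obtain c where "colouring E S (chi E S) c"
    using chi_colouring[OF assms(1,2)] .
  then show ?thesis
    using assms(3) by (fastforce simp: colouring_def)
qed

lemma chi_independent:
  assumes "\<forall>u\<in>S. \<forall>v\<in>S. \<not> E u v"
  shows "chi E S \<le> 1"
  using chi_le[of E S 1 "\<lambda>_. 0"] assms by (simp add: colouring_def)

lemma chi_Un:
  assumes "finite S" "finite T" "irreflp E"
  shows "chi E (S \<union> T) \<le> chi E S + chi E T"
proof -
  obtain c where c: "colouring E S (chi E S) c"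
    using chi_colouring[OF assms(1,3)] .
  obtain d where d: "colouring E T (chi E T) d"
    using chi_colouring[OF assms(2,3)] .
  have "colouring E (S \<union> T) (chi E S + chi E T) (\<lambda>v. if v \<in> S then c v else chi E S + d v)"
    using c d by (fastforce simp: colouring_def)
  then show ?thesis by (rule chi_le)
qed

lemma chi_remove:
  assumes "finite S" "irreflp E"
  shows "chi E S \<le> chi E (S - {v}) + 1"
proof -
  have "chi E S \<le> chi E ((S - {v}) \<union> {v})"
    by (rule chi_mono) (use assms in auto)
  also have "\<dots> \<le> chi E (S - {v}) + chi E {v}"
    by (rule chi_Un) (use assms in auto)
  finally show ?thesis
    using chi_independent[of "{v}" E] assms(2) by (simp add: irreflp_def)
qed

text \<open>
  Two nonadjacent vertices can share one new colour.
\<close>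

lemma chi_Un_nonadjacent:
  assumes "finite S" "irreflp E" "symp E" "u \<in> S" "v \<in> S" "\<not> E u v"
  shows "chi E S \<le> chi E (S - {u, v}) + 1"
proof -
  have "S = (S - {u, v}) \<union> {u, v}"
    using assms(4,5) by auto
  then have "chi E S = chi E ((S - {u, v}) \<union> {u, v})"
    by simp
  also have "\<dots> \<le> chi E (S - {u, v}) + chi E {u, v}"
    by (rule chi_Un) (use assms in auto)
  finally show ?thesis
    using chi_independent[of "{u, v}" E] assms by (fastforce simp: irreflp_def symp_def)
qed

lemma clique_if_chi_eq_card:
  assumes "finite S" "irreflp E" "symp E" "chi E S = card S" "u \<in> S" "v \<in> S" "u \<noteq> v"
  shows "E u v"
proof (rule ccontr)
  assume "\<not> E u v"
  then have "chi E S \<le> chi E (S - {u, v}) + 1"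
    using chi_Un_nonadjacent assms by metis
  also have "\<dots> \<le> card (S - {u, v}) + 1"
    using chi_le_card[of "S - {u, v}" E] assms by simp
  also have "card (S - {u, v}) = card S - 2"
    using assms by (subst card_Diff_subset) auto
  finally show False
    using assms card_mono[of S "{u, v}"] by simp
qed

lemma colouring_extend:
  assumes "symp E" "irreflp E" "colouring E (S - {v}) k c" "i < k" "i \<notin> c ` nbrs E S v"
  shows "colouring E S k (c(v := i))"
  using assms by (fastforce simp: colouring_def nbrs_def symp_def irreflp_def)

text \<open>
  The vertices of \<open>C\<close> are coloured one after the other: each sees fewer than \<open>k\<close> colours, whatever
  has been coloured before.
\<close>

lemma chi_le_by_greedy:
  assumes "finite C" "finite S" "symp E" "irreflp E"
    and "chi E (S - C) \<le> k" "\<And>v. v \<in> C \<Longrightarrow> card (nbrs E S v) < k"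
  shows "chi E S \<le> k"
  using assms(1,5,6)
proof (induction C rule: finite_induct)
  case empty
  then show ?case by simp
next
  case (insert x C)
  have "S - insert x C = (S - C) - {x}"
    by auto
  then obtain c where c: "colouring E (S - C - {x}) k c"
    using chi_le_colouring[of "S - insert x C" E k] insert.prems(1) assms by auto
  have "card (c ` nbrs E (S - C) x) \<le> card (nbrs E (S - C) x)"
    by (rule card_image_le) (use assms in auto)
  also have "\<dots> \<le> card (nbrs E S x)"
    by (rule card_mono) (use assms in \<open>auto intro!: nbrs_mono\<close>)
  also have "\<dots> < card {..<k}"
    using insert.prems by simp
  finally have "\<not> {..<k} \<subseteq> c ` nbrs E (S - C) x"
    using assms(2) by (meson card_mono finite_Diff finite_imageI finite_nbrs leD)
  then obtain i where "i < k" "i \<notin> c ` nbrs E (S - C) x"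
    by auto
  then have "chi E (S - C) \<le> k"
    using colouring_extend[OF assms(3,4) c] chi_le by metis
  then show ?case
    using insert by auto
qed

lemma chi_le_degree_if_critical:
  assumes "finite S" "symp E" "irreflp E" "chi E (S - {v}) < chi E S"
  shows "chi E (S - {v}) \<le> card (nbrs E S v)"
proof (rule ccontr)
  assume "\<not> ?thesis"
  then have "chi E S \<le> chi E (S - {v})"
    by (intro chi_le_by_greedy[OF _ assms(1-3), of "{v}"]) auto
  then show False
    using assms(4) by simp
qed

section \<open>The Nordhaus--Gaddum bound and its extremal graphs\<close>

definition NG :: "('a \<Rightarrow> 'a \<Rightarrow> bool) \<Rightarrow> 'a set \<Rightarrow> bool" where
  "NG E S \<longleftrightarrow> chi E S + chi (co E) S = card S + 1"

lemma NG_co: "irreflp E \<Longrightarrow> NG (co E) S \<longleftrightarrow> NG E S"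
  by (auto simp: NG_def co_co)

text \<open>
  Induction on the number of vertices.  Removing \<open>v\<close> lowers the sum of the chromatic numbers by at
  most 2, and by 2 only if \<open>v\<close> has large degree in both \<open>E\<close> and \<open>co E\<close>; these degrees add up to
  \<open>card S - 1\<close>, which then already bounds the sum for the remaining vertices.
\<close>

lemma nordhaus_gaddum:
  assumes "finite S" "symp E" "irreflp E"
  shows "chi E S + chi (co E) S \<le> card S + 1"
  using assms(1)
proof (induction "card S" arbitrary: S)
  case 0
  then show ?case by simp
next
  case (Suc n)
  then obtain v where v: "v \<in> S"
    by (metis Suc_neq_Zero card.empty ex_in_conv)
  note co = symp_co[OF assms(2)] irreflp_co[of E]
  have cn: "card (S - {v}) = n"
    using Suc v by simp
  have IH: "chi E (S - {v}) + chi (co E) (S - {v}) \<le> n + 1"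
    using Suc(1)[of "S - {v}"] cn Suc.prems by simp
  have *: "chi E S \<le> chi E (S - {v}) + 1" "chi (co E) S \<le> chi (co E) (S - {v}) + 1"
    by (rule chi_remove[OF Suc.prems assms(3)], rule chi_remove[OF Suc.prems co(2)])
  show ?case
  proof (rule ccontr)
    assume "\<not> ?thesis"
    then have "chi E (S - {v}) < chi E S" "chi (co E) (S - {v}) < chi (co E) S"
      "chi E (S - {v}) + chi (co E) (S - {v}) \<ge> n + 1"
      using * IH Suc(2) by linarith+
    then show False
      using chi_le_degree_if_critical[OF Suc.prems assms(2,3), of v]
        chi_le_degree_if_critical[OF Suc.prems co, of v]
        card_nbrs_co[OF Suc.prems v assms(3)] Suc(2) by linarith
  qed
qed

text \<open>
  The classes \<open>A\<close>, \<open>B\<close>, \<open>C\<close> of the introduction.  The degree is incremented to stay clear of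
  truncated subtraction.
\<close>

definition mid :: "('a \<Rightarrow> 'a \<Rightarrow> bool) \<Rightarrow> 'a set \<Rightarrow> 'a set" where
  "mid E S = {v \<in> S. card (nbrs E S v) + 1 = chi E S}"

definition high :: "('a \<Rightarrow> 'a \<Rightarrow> bool) \<Rightarrow> 'a set \<Rightarrow> 'a set" where
  "high E S = {v \<in> S. card (nbrs E S v) + 1 > chi E S}"

definition low :: "('a \<Rightarrow> 'a \<Rightarrow> bool) \<Rightarrow> 'a set \<Rightarrow> 'a set" where
  "low E S = {v \<in> S. card (nbrs E S v) + 1 < chi E S}"

lemma mid_high_low_partition:
  "S = mid E S \<union> high E S \<union> low E S" "mid E S \<inter> high E S = {}"
  "mid E S \<inter> low E S = {}" "high E S \<inter> low E S = {}"
  by (auto simp: mid_def high_def low_def)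

lemma card_levels:
  assumes "finite S"
  shows "card S = card (mid E S) + card (high E S) + card (low E S)"
proof -
  have "finite (mid E S)" "finite (high E S)" "finite (low E S)"
    using assms by (auto simp: mid_def high_def low_def)
  then show ?thesis
    using mid_high_low_partition[where E = E and S = S]
    by (metis (no_types, lifting) card_Un_disjoint finite_UnI inf_sup_distrib2 sup_bot.right_neutral)
qed

text \<open>
  The two degrees of a vertex sum to \<open>card S - 1\<close> and the two chromatic numbers to \<open>card S + 1\<close>, so
  an excess of the degree over \<open>chi - 1\<close> in \<open>E\<close> is a deficit of the same size in \<open>co E\<close>.  All later
  dualities rest on this.
\<close>

lemma co_swaps_levels:
  assumes "finite S" "irreflp E" "NG E S"
  shows "mid (co E) S = mid E S" "high (co E) S = low E S" "low (co E) S = high E S"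
proof -
  have "card (nbrs E S v) + card (nbrs (co E) S v) + 2 = chi E S + chi (co E) S" if "v \<in> S" for v
    using card_nbrs_co[OF assms(1) that assms(2)] assms(3) by (simp add: NG_def)
  then show "mid (co E) S = mid E S" "high (co E) S = low E S" "low (co E) S = high E S"
    unfolding mid_def high_def low_def by fastforce+
qed

text \<open>
  Otherwise the remaining vertices could be added greedily to a colouring with \<open>chi E S - 1\<close> colours.
\<close>

lemma chi_le_chi_mid_high:
  assumes "finite S" "symp E" "irreflp E"
  shows "chi E S \<le> chi E (mid E S \<union> high E S)"
proof (rule ccontr)
  assume *: "\<not> ?thesis"
  have "S - low E S = mid E S \<union> high E S"
    by (auto simp: mid_def high_def low_def)
  moreover have "finite (low E S)"
    using assms(1) by (simp add: low_def)
  moreover have "card (nbrs E S v) < chi E S - 1" if "v \<in> low E S" for v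
    using that by (auto simp: low_def)
  ultimately have "chi E S \<le> chi E S - 1"
    using chi_le_by_greedy[of "low E S" S E "chi E S - 1"] assms * by fastforce
  then show False
    using * by simp
qed

text \<open>
  The vertices \<open>u\<close> and \<open>v\<close> share a colour, every other vertex of \<open>high E S\<close> gets its own.
\<close>

lemma chi_mid_high_le:
  assumes "finite S" "irreflp E" "u \<in> mid E S" "v \<in> high E S" "\<not> E u v" "symp E"
  shows "chi E (mid E S \<union> high E S) \<le> chi E (mid E S - {u}) + card (high E S)"
proof -
  have fin: "finite (mid E S)" "finite (high E S)" "u \<notin> high E S" "v \<notin> mid E S"
    using assms(1,3,4) by (auto simp: mid_def high_def)
  have "chi E (mid E S \<union> high E S) \<le> chi E (mid E S \<union> high E S - {u, v}) + 1"
    using chi_Un_nonadjacent assms fin by (metis UnCI finite_UnI)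
  moreover have "mid E S \<union> high E S - {u, v} = (mid E S - {u}) \<union> (high E S - {v})"
    using fin by auto
  moreover have "chi E ((mid E S - {u}) \<union> (high E S - {v})) \<le> chi E (mid E S - {u}) + chi E (high E S - {v})"
    by (rule chi_Un) (use fin assms in auto)
  moreover have "chi E (high E S - {v}) \<le> card (high E S - {v})"
    by (rule chi_le_card) (use fin assms in auto)
  moreover have "card (high E S - {v}) + 1 = card (high E S)"
    using fin assms by (metis Suc_eq_plus1 card_Suc_Diff1)
  ultimately show ?thesis by simp
qed

text \<open>
  All parts come from one chain of inequalities that adds up to the bound \<open>card S + 1\<close> and therefore
  has no slack anywhere.
\<close>

lemma NG_decomposition:
  assumes "finite S" "symp E" "irreflp E" "NG E S"
  shows "NG E (mid E S)" "mid E S \<noteq> {}"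
    "chi E S = chi E (mid E S) + card (high E S)"
    "chi E (high E S) = card (high E S)"
    "chi (co E) S = chi (co E) (mid E S) + card (low E S)"
    "chi (co E) (low E S) = card (low E S)"
proof -
  note co = symp_co[OF assms(2)] irreflp_co[of E]
  let ?A = "mid E S" and ?B = "high E S" and ?C = "low E S"
  have fin: "finite ?A" "finite ?B" "finite ?C"
    using assms(1) by (auto simp: mid_def high_def low_def)
  have "chi E S \<le> chi E ?A + chi E ?B"
    using chi_le_chi_mid_high[OF assms(1-3)] chi_Un[OF fin(1,2) assms(3)] by linarith
  moreover have "chi (co E) S \<le> chi (co E) ?A + chi (co E) ?C"
    using chi_le_chi_mid_high[OF assms(1) co] chi_Un[OF fin(1,3) co(2)]
      co_swaps_levels[OF assms(1,3,4)] by simp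
  moreover have "chi E ?B \<le> card ?B" "chi (co E) ?C \<le> card ?C"
    using chi_le_card fin assms(3) co(2) by blast+
  moreover have NG: "chi E ?A + chi (co E) ?A \<le> card ?A + 1"
    using nordhaus_gaddum fin(1) assms(2,3) .
  moreover have card: "card S = card ?A + card ?B + card ?C"
    by (rule card_levels[OF assms(1)])
  moreover have sum: "chi E S + chi (co E) S = card S + 1"
    using assms(4) by (simp add: NG_def)
  ultimately show "NG E ?A" "chi E S = chi E ?A + card ?B" "chi E ?B = card ?B"
    "chi (co E) S = chi (co E) ?A + card ?C" "chi (co E) ?C = card ?C"
    unfolding NG_def by linarith+
  then have "chi E ?A + chi (co E) ?A = card ?A + 1"
    by (simp add: NG_def)
  then show "?A \<noteq> {}"
    by auto
qed

text \<open>
  If \<open>u\<close> missed some \<open>v\<close>, colouring them alike would force \<open>chi E (mid E S - {u}) = chi E (mid E S)\<close>.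
  Since \<open>mid E S\<close> is extremal, the complementary chromatic number then drops when \<open>u\<close> is removed.  By
  the dual argument \<open>u\<close> has no neighbour in \<open>low E S\<close>, and the drop bounds its degree inside
  \<open>mid E S\<close>; together with the missing neighbour \<open>v\<close> its degree becomes too small for \<open>mid E S\<close>.
\<close>

lemma NG_mid_high_joined:
  assumes "finite S" "symp E" "irreflp E" "NG E S" "u \<in> mid E S" "v \<in> high E S"
  shows "E u v"
proof (rule ccontr)
  assume "\<not> E u v"
  note co = symp_co[OF assms(2)] irreflp_co[of E]
  let ?A = "mid E S" and ?B = "high E S" and ?C = "low E S"
  note d = NG_decomposition[OF assms(1-4)]
  have fin: "finite ?A" "finite ?B" "finite ?C"
    using assms(1) by (auto simp: mid_def high_def low_def)
  have A: "chi E (?A - {u}) + chi (co E) (?A - {u}) \<le> card (?A - {u}) + 1"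
    using nordhaus_gaddum[of "?A - {u}" E] fin assms by simp
  have cA: "card (?A - {u}) + 1 = card ?A"
    using fin assms(5) by (metis Suc_eq_plus1 card_Suc_Diff1)
  have NGA: "chi E ?A + chi (co E) ?A = card ?A + 1"
    using d(1) by (simp add: NG_def)
  have "chi E S \<le> chi E (?A - {u}) + card ?B"
    using chi_le_chi_mid_high[OF assms(1-3)] chi_mid_high_le[OF assms(1,3,5,6) \<open>\<not> E u v\<close> assms(2)]
    by linarith
  then have ge: "chi E (?A - {u}) \<ge> chi E ?A"
    using d(3) by linarith
  (* The dual of the bound above would save a colour in the complement as well. *)
  have "nbrs E ?C u = {}"
  proof (rule ccontr)
    assume "nbrs E ?C u \<noteq> {}"
    then obtain w where w: "w \<in> ?C" "E u w"
      by (auto simp: nbrs_def)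
    then have "chi (co E) S \<le> chi (co E) (?A - {u}) + card ?C"
      using chi_le_chi_mid_high[OF assms(1) co] chi_mid_high_le[OF assms(1) co(2), of u w]
        co_swaps_levels[OF assms(1,3,4)] assms(5) co by (simp add: co_def)
    then show False
      using d(5) ge A cA NGA by linarith
  qed
  then have "nbrs E S u = nbrs E ?A u \<union> nbrs E ?B u"
    using mid_high_low_partition(1)[where E = E and S = S] unfolding nbrs_def by blast
  then have "card (nbrs E S u) \<le> card (nbrs E ?A u) + card (nbrs E ?B u)"
    by (simp add: card_Un_le)
  moreover have "nbrs E ?B u \<subset> ?B"
    using \<open>\<not> E u v\<close> assms(6) by (auto simp: nbrs_def)
  then have "card (nbrs E ?B u) < card ?B"
    using fin by (simp add: psubset_card_mono)
  moreover have "chi (co E) (?A - {u}) < chi (co E) ?A"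
    using ge A cA NGA by linarith
  then have "chi (co E) (?A - {u}) \<le> card (nbrs (co E) ?A u)"
    using chi_le_degree_if_critical[OF fin(1) co] by blast
  moreover have "chi (co E) ?A \<le> chi (co E) (?A - {u}) + 1"
    using chi_remove[OF fin(1) co(2)] .
  moreover have "card (nbrs E ?A u) + card (nbrs (co E) ?A u) + 1 = card ?A"
    using card_nbrs_co[OF fin(1) assms(5,3)] .
  moreover have "card (nbrs E S u) + 1 = chi E S"
    using assms(5) by (simp add: mid_def)
  ultimately show False
    using d(3) NGA by linarith
qed

lemma NG_mid_low_separated:
  assumes "finite S" "symp E" "irreflp E" "NG E S" "u \<in> mid E S" "w \<in> low E S"
  shows "\<not> E u w"
  using NG_mid_high_joined[of S "co E" u w] co_swaps_levels[OF assms(1,3,4)] assms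
  by (auto simp: symp_co irreflp_co NG_co co_def)

lemma NG_mid_regular:
  assumes "finite S" "symp E" "irreflp E" "NG E S" "u \<in> mid E S"
  shows "card (nbrs E (mid E S) u) + 1 = chi E (mid E S)"
proof -
  have "nbrs E S u = nbrs E (mid E S) u \<union> high E S"
    using NG_mid_high_joined[OF assms] NG_mid_low_separated[OF assms]
      mid_high_low_partition(1)[where E = E and S = S]
    unfolding nbrs_def by blast
  moreover have "finite (mid E S)" "finite (high E S)" "nbrs E (mid E S) u \<inter> high E S = {}"
    using assms(1) by (auto simp: mid_def high_def nbrs_def)
  ultimately have "card (nbrs E S u) = card (nbrs E (mid E S) u) + card (high E S)"
    by (simp add: card_Un_disjoint)
  moreover have "card (nbrs E S u) + 1 = chi E S"
    using assms(5) by (simp add: mid_def)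
  ultimately show ?thesis
    using NG_decomposition(3)[OF assms(1-4)] by linarith
qed

section \<open>Critical regular graphs\<close>

text \<open>
  The degree \<open>d\<close> is as small as the chromatic number permits.  Below, \<open>c\<close> is a \<open>d\<close>-colouring of
  all vertices but \<open>u\<close>; it must show every colour exactly once around \<open>u\<close>.  The uncoloured spot can
  be moved along any edge, and this rigidity then holds at its new position as well.
\<close>

locale critical_regular =
  fixes E :: "'a \<Rightarrow> 'a \<Rightarrow> bool" and S :: "'a set" and d :: nat
  assumes finite: "finite S" and sym: "symp E" and irrefl: "irreflp E"
    and regular: "\<And>v. v \<in> S \<Longrightarrow> card (nbrs E S v) = d"
    and chi: "d < chi E S"
begin

lemma rainbow:
  assumes "u \<in> S" "colouring E (S - {u}) d c"
  shows "bij_betw c (nbrs E S u) {..<d}"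
proof -
  have "c ` nbrs E S u \<subseteq> {..<d}"
    using assms irrefl by (auto simp: colouring_def nbrs_def irreflp_def)
  moreover have "{..<d} \<subseteq> c ` nbrs E S u"
  proof (rule ccontr)
    assume "\<not> ?thesis"
    then obtain i where "i < d" "i \<notin> c ` nbrs E S u"
      by auto
    then have "chi E S \<le> d"
      using colouring_extend[OF sym irrefl assms(2)] chi_le by metis
    then show False
      using chi by simp
  qed
  ultimately have im: "c ` nbrs E S u = {..<d}" ..
  moreover have "inj_on c (nbrs E S u)"
    using im regular[OF assms(1)] finite by (intro eq_card_imp_inj_on) auto
  ultimately show ?thesis
    by (simp add: bij_betw_def)
qed

lemma colours_inj:
  assumes "u \<in> S" "colouring E (S - {u}) d c"
    and "x \<in> S" "E u x" "y \<in> S" "E u y" "c x = c y"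
  shows "x = y"
  using rainbow[OF assms(1,2)] assms by (auto simp: bij_betw_def nbrs_def dest: inj_onD)

lemma colours_surj:
  assumes "u \<in> S" "colouring E (S - {u}) d c" "i < d"
  obtains x where "x \<in> S" "E u x" "c x = i"
proof -
  have "i \<in> c ` nbrs E S u"
    using rainbow[OF assms(1,2)] assms(3) by (auto simp: bij_betw_def)
  then show thesis
    using that by (auto simp: nbrs_def)
qed

lemma shift:
  assumes "u \<in> S" "colouring E (S - {u}) d c" "y \<in> S" "E u y"
  shows "colouring E (S - {y}) d (c(u := c y))"
proof -
  have "u \<noteq> y"
    using assms(4) irrefl by (auto simp: irreflp_def)
  moreover have "\<forall>w\<in>S. w \<noteq> y \<and> (E u w \<or> E w u) \<longrightarrow> c w \<noteq> c y"
    using colours_inj[OF assms(1,2) _ _ assms(3,4)] sym by (metis sympD)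
  ultimately show ?thesis
    using assms irrefl unfolding colouring_def by (auto simp: irreflp_def)
qed

text \<open>
  After the uncoloured spot is moved from \<open>u\<close> to \<open>y\<close>, the neighbours of \<open>y\<close> show every colour
  once, and \<open>u\<close> accounts for the colour \<open>c y\<close> only.
\<close>

lemma nbr_of_colour:
  assumes "u \<in> S" "colouring E (S - {u}) d c" "y \<in> S" "E u y" "i < d" "i \<noteq> c y"
  obtains w where "w \<in> S - {u}" "E y w" "c w = i"
proof -
  obtain w where w: "w \<in> S" "E y w" "(c(u := c y)) w = i"
    using colours_surj[OF assms(3) shift[OF assms(1-4)] assms(5)] .
  then show thesis
    using that[of w] assms(6) by (auto split: if_splits)
qed

lemma nbr_of_colour_unique:
  assumes "u \<in> S" "colouring E (S - {u}) d c" "y \<in> S" "E u y"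
    and "w \<in> S - {u}" "E y w" "x \<in> S - {u}" "E y x" "c w = c x"
  shows "w = x"
  using colours_inj[OF assms(3) shift[OF assms(1-4)], of w x] assms by auto

text \<open>
  The vertex \<open>z\<close> is the neighbour of \<open>y\<close> with the colour of \<open>y'\<close>.  With the uncoloured spot moved to
  \<open>y\<close>, the vertex \<open>z\<close> has in turn a neighbour \<open>x\<close> in the old colour class of \<open>y\<close>; it is not \<open>u\<close>, which
  now has that colour, because \<open>u\<close> and \<open>z\<close> are not adjacent.
\<close>

lemma twin:
  assumes "u \<in> S" "colouring E (S - {u}) d c" "y \<in> S" "E u y" "y' \<in> S" "E u y'"
    and "y \<noteq> y'" "\<not> E y y'"
  obtains x z where "x \<in> S" "x \<noteq> u" "\<not> E u x" "c x = c y"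
    "z \<in> S" "z \<noteq> u" "\<not> E u z" "c z = c y'" "E y z" "E z x"
proof -
  note inj = colours_inj[OF assms(1,2)]
  have ne: "u \<noteq> y" "u \<noteq> y'"
    using assms irrefl by (auto simp: irreflp_def)
  have lt: "c y < d" "c y' < d"
    using assms(2,3,5) ne by (auto simp: colouring_def)
  have cne: "c y \<noteq> c y'"
    using inj assms(3-7) by blast
  obtain z where z: "z \<in> S - {u}" "E y z" "c z = c y'"
    using nbr_of_colour[OF assms(1-4) lt(2)] cne by metis
  have uz: "\<not> E u z"
    using inj[of z y'] z assms by auto
  obtain x where x: "x \<in> S - {y}" "E z x" "(c(u := c y)) x = c y"
    using nbr_of_colour[OF assms(3) shift[OF assms(1-4)], of z "c y"] z lt cne by auto
  have "x \<noteq> u"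
    using uz x(2) sym by (auto simp: symp_def)
  then have "c x = c y"
    using x by simp
  moreover have "\<not> E u x"
    using inj[of x y] x assms calculation by auto
  ultimately show thesis
    using that[of x z] x z uz \<open>x \<noteq> u\<close> by auto
qed

text \<open>
  For two such vertices \<open>y1\<close> and \<open>y2\<close>, injectivity of \<open>c\<close> on the non-neighbours of \<open>u\<close> provides a
  common neighbour \<open>z\<close> with the colour of \<open>y\<close>.  It is adjacent to \<open>y2\<close> and to the twin of \<open>y2\<close>, which
  have the same colour; that is impossible once the uncoloured spot is at \<open>y1\<close>.
\<close>

lemma at_most_one_non_nbr:
  assumes u: "u \<in> S" and c: "colouring E (S - {u}) d c"
    and inj: "inj_on c (nbrs (co E) S u)"
    and y: "y \<in> S" "E u y" and y1: "y1 \<in> S" "E u y1" and y2: "y2 \<in> S" "E u y2"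
    and ne: "y1 \<noteq> y" "y2 \<noteq> y" and nonadj: "\<not> E y1 y" "\<not> E y2 y"
  shows "y1 = y2"
proof (rule ccontr)
  assume "y1 \<noteq> y2"
  obtain x1 z1 where 1: "z1 \<in> S" "z1 \<noteq> u" "\<not> E u z1" "c z1 = c y" "E y1 z1"
    using twin[OF u c y1 y ne(1) nonadj(1)] by metis
  obtain x2 z2 where 2: "x2 \<in> S" "x2 \<noteq> u" "\<not> E u x2" "c x2 = c y2"
    "z2 \<in> S" "z2 \<noteq> u" "\<not> E u z2" "c z2 = c y" "E y2 z2" "E z2 x2"
    using twin[OF u c y2 y ne(2) nonadj(2)] .
  have "z1 = z2"
    using inj 1 2 by (auto simp: inj_on_def nbrs_def co_def)
  have "c y1 \<noteq> c y2"
    using colours_inj[OF u c y1 y2] \<open>y1 \<noteq> y2\<close> by blast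
  then have "x2 \<noteq> y1"
    using 2(4) by auto
  moreover have "y2 \<noteq> u" "E z1 y2" "E z1 x2"
    using y2 2 \<open>z1 = z2\<close> sym irrefl by (auto simp: symp_def irreflp_def)
  ultimately have "y2 = x2"
    using nbr_of_colour_unique[OF y1(1) shift[OF u c y1] 1(1,5), of y2 x2] 2 y2 \<open>y1 \<noteq> y2\<close>
    by simp
  then show False
    using 2 y2 by simp
qed

end

definition five_cycle_on :: "('a \<Rightarrow> 'a \<Rightarrow> bool) \<Rightarrow> 'a set \<Rightarrow> bool" where
  "five_cycle_on E S \<longleftrightarrow> (\<exists>f. bij_betw f {..<5} S \<and>
     (\<forall>i<5. \<forall>j<5. E (f i) (f j) \<longleftrightarrow> j = Suc i mod 5 \<or> i = Suc j mod 5))"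

text \<open>
  Here \<open>k\<close> partitions the vertices other than \<open>u\<close> into \<open>e\<close> cliques.  The assumptions are symmetric
  under exchanging \<open>E\<close> with its complement.
\<close>

locale doubly_critical =
  fixes E :: "'a \<Rightarrow> 'a \<Rightarrow> bool" and S :: "'a set" and d e :: nat and u :: 'a
    and c k :: "'a \<Rightarrow> nat"
  assumes critical: "critical_regular E S d" and co_critical: "critical_regular (co E) S e"
    and u: "u \<in> S"
    and c: "colouring E (S - {u}) d c" and k: "colouring (co E) (S - {u}) e k"
begin

abbreviation "Y \<equiv> nbrs E S u"
abbreviation "Z \<equiv> nbrs (co E) S u"

interpretation G: critical_regular E S d by (rule critical)
interpretation H: critical_regular "co E" S e by (rule co_critical)

lemma dual: "doubly_critical (co E) S e d u k c"
  using critical co_critical u c k G.irrefl by (simp add: doubly_critical_def co_co)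

lemma S_eq: "S = insert u (Y \<union> Z)"
  using u by (auto simp: nbrs_def co_def)

lemma disjoint: "u \<notin> Y" "u \<notin> Z" "Y \<inter> Z = {}"
  using G.irrefl by (auto simp: nbrs_def co_def irreflp_def)

lemma card_Y: "card Y = d" and card_Z: "card Z = e"
  using G.regular H.regular u by auto

lemma finite_Y: "finite Y" and finite_Z: "finite Z"
  using G.finite by auto

text \<open>
  The vertex \<open>y\<close> shares its clique of the partition \<open>k\<close> with some \<open>z \<in> Z\<close>.  So \<open>u\<close> and \<open>z\<close> already
  take two of its \<open>d\<close> neighbours, which leaves too few to cover the \<open>d - 1\<close> other elements of \<open>Y\<close>.
\<close>

lemma has_non_nbr:
  assumes "y \<in> Y"
  shows "\<exists>y'\<in>Y. y' \<noteq> y \<and> \<not> E y y'"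
proof (rule ccontr)
  assume *: "\<not> ?thesis"
  have yS: "y \<in> S" "E u y" "y \<noteq> u"
    using assms G.irrefl by (auto simp: nbrs_def irreflp_def)
  then have "k y < e"
    using k by (auto simp: colouring_def)
  then obtain z where z: "z \<in> S" "co E u z" "k z = k y"
    using H.colours_surj[OF u k] by metis
  then have zZ: "z \<in> Z"
    by (simp add: nbrs_def)
  then have ne: "z \<noteq> y" "z \<noteq> u" "z \<notin> Y"
    using disjoint assms by auto
  then have "E y z"
    using k z yS unfolding colouring_def co_def by (metis DiffI singletonD)
  (* If y were adjacent to all of Y, this would be d + 1 neighbours. *)
  have "insert u (insert z (Y - {y})) \<subseteq> nbrs E S y"
    using * \<open>E y z\<close> z yS u G.sym by (auto simp: nbrs_def symp_def)
  then have "card (insert u (insert z (Y - {y}))) \<le> d"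
    using G.regular[OF yS(1)] card_mono finite_nbrs[OF G.finite] by metis
  moreover have "card (insert u (insert z (Y - {y}))) = card Y + 1"
    using ne disjoint(1) assms finite_Y card_Suc_Diff1[OF finite_Y assms] by simp
  ultimately show False
    using card_Y by simp
qed

text \<open>
  Each colour occurs at some \<open>y \<in> Y\<close>, and \<open>y\<close> has a twin in \<open>Z\<close>.
\<close>

lemma Z_has_all_colours: "{..<d} \<subseteq> c ` Z"
proof
  fix i assume "i \<in> {..<d}"
  then obtain y where y: "y \<in> S" "E u y" "c y = i"
    using G.colours_surj[OF u c] by auto
  then obtain y' where y': "y' \<in> S" "E u y'" "y \<noteq> y'" "\<not> E y y'"
    using has_non_nbr[of y] by (auto simp: nbrs_def)
  obtain x z where "x \<in> S" "x \<noteq> u" "\<not> E u x" "c x = c y"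
    using G.twin[OF u c y(1,2) y'] .
  then show "i \<in> c ` Z"
    using y by (auto simp: nbrs_def co_def)
qed

lemma d_le_e: "d \<le> e"
  using surj_card_le[OF finite_Z Z_has_all_colours] card_Z by simp

lemma d_eq_e: "d = e"
  using d_le_e doubly_critical.d_le_e[OF dual] by simp

lemma inj_c: "inj_on c Z"
proof -
  have "c ` Z \<subseteq> {..<d}"
    using c by (auto simp: colouring_def nbrs_def co_def)
  then have "c ` Z = {..<d}"
    using Z_has_all_colours by blast
  then show ?thesis
    using card_Z d_eq_e finite_Z by (intro eq_card_imp_inj_on) auto
qed

text \<open>
  Inside \<open>Y\<close>, the vertex \<open>y\<close> is adjacent to all but exactly one of the \<open>d - 1\<close> other vertices; with
  \<open>u\<close> this leaves one neighbour for \<open>Z\<close>.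
\<close>

lemma card_nbrs_in_Z:
  assumes "y \<in> Y"
  shows "card (nbrs E Z y) = 1"
proof -
  have y: "y \<in> S" "E u y"
    using assms by (auto simp: nbrs_def)
  obtain y' where y': "y' \<in> Y" "y' \<noteq> y" "\<not> E y y'"
    using has_non_nbr[OF assms] by blast
  have "\<forall>w\<in>Y. w \<noteq> y \<and> \<not> E y w \<longrightarrow> w = y'"
    using G.at_most_one_non_nbr[OF u c inj_c y, of _ y'] y' G.sym
    by (auto simp: nbrs_def symp_def)
  then have "nbrs E Y y = Y - {y, y'}"
    using y' irreflpD[OF G.irrefl] unfolding nbrs_def[of E Y] by blast
  moreover have "card (Y - {y, y'}) + 2 = card Y"
    using y' assms finite_Y card_mono[of Y "{y, y'}"] by (subst card_Diff_subset) auto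
  ultimately have "card (nbrs E Y y) + 2 = d"
    using card_Y by simp
  moreover have "E y u"
    using y G.sym by (simp add: symp_def)
  then have "nbrs E (insert u (Y \<union> Z)) y = insert u (nbrs E Y y \<union> nbrs E Z y)"
    unfolding nbrs_def[of E "insert u (Y \<union> Z)"] nbrs_def[of E Y] nbrs_def[of E Z] by blast
  then have split: "nbrs E S y = insert u (nbrs E Y y \<union> nbrs E Z y)"
    by (simp only: S_eq[symmetric])
  have "u \<notin> nbrs E Y y \<union> nbrs E Z y" "nbrs E Y y \<inter> nbrs E Z y = {}"
    using disjoint nbrs_subset[of E Y y] nbrs_subset[of E Z y] by blast+
  then have "card (nbrs E S y) = card (nbrs E Y y) + card (nbrs E Z y) + 1"
    unfolding split using finite_Y finite_Z by (simp add: card_Un_disjoint)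
  ultimately show ?thesis
    using G.regular[OF y(1)] by linarith
qed

lemma card_nbrs_in_Y:
  assumes "z \<in> Z"
  shows "card (nbrs E Y z) + 1 = d"
proof -
  have "card (nbrs (co E) Y z) = 1"
    using doubly_critical.card_nbrs_in_Z[OF dual assms] G.irrefl by (simp add: co_co)
  moreover have "Y = nbrs E Y z \<union> nbrs (co E) Y z"
    using assms disjoint unfolding nbrs_def[of _ Y] co_def[of E z] by blast
  moreover have "nbrs E Y z \<inter> nbrs (co E) Y z = {}"
    by (auto simp: nbrs_def co_def)
  ultimately show ?thesis
    using card_Y finite_Y by (metis card_Un_disjoint finite_nbrs)
qed

text \<open>
  Double counting of the edges between \<open>Y\<close> and \<open>Z\<close>.
\<close>

lemma d_cases: "d = 0 \<or> d = 2"
proof -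
  have across: "{z \<in> Z. E y z} = nbrs E Z y" "{y \<in> Y. E y z} = nbrs E Y z" for y z
    using sympD[OF G.sym] by (auto simp: nbrs_def)
  have "(\<Sum>y\<in>Y. card (nbrs E Z y)) = (\<Sum>z\<in>Z. card (nbrs E Y z))"
    using sum.swap_restrict[OF finite_Y finite_Z, of "\<lambda>_ _. 1::nat" E] by (simp add: across)
  moreover have "(\<Sum>y\<in>Y. card (nbrs E Z y)) = (\<Sum>y\<in>Y. 1)"
    by (rule sum.cong) (simp_all only: card_nbrs_in_Z)
  moreover have "(\<Sum>z\<in>Z. card (nbrs E Y z)) = (\<Sum>z\<in>Z. d - 1)"
    by (rule sum.cong) (use card_nbrs_in_Y in fastforce)+
  ultimately have "d * 1 = d * (d - 1)"
    using card_Y card_Z d_eq_e by simp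
  then show ?thesis
    unfolding mult_cancel1 by auto
qed

lemma edgeless_or_five_cycle:
  "(\<forall>v\<in>S. \<forall>w\<in>S. \<not> E v w) \<or> five_cycle_on E S"
proof (cases "d = 0")
  case True
  then have "Y = {}" "Z = {}"
    using card_Y card_Z d_eq_e finite_Y finite_Z by auto
  then have "insert u (Y \<union> Z) = {u}"
    by simp
  then have "S = {u}"
    by (simp only: S_eq[symmetric])
  then show ?thesis
    using G.irrefl by (auto simp: irreflp_def)
next
  case False
  then have 2: "card Y = 2" "card Z = 2"
    using d_cases card_Y card_Z d_eq_e by auto
  then obtain y1 y2 where Y: "Y = {y1, y2}" "y1 \<noteq> y2"
    by (auto simp: card_2_iff)
  obtain z1 where z1: "nbrs E Z y1 = {z1}"
    using card_nbrs_in_Z[of y1] Y by (auto simp: card_1_singleton_iff)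
  obtain z2 where z2: "nbrs E Z y2 = {z2}"
    using card_nbrs_in_Z[of y2] Y by (auto simp: card_1_singleton_iff)
  have z: "z1 \<in> Z" "z2 \<in> Z" "E y1 z1" "E y2 z2"
    using z1 z2 by (auto simp: nbrs_def)
  have "z1 \<noteq> z2"
  proof
    assume "z1 = z2"
    then have "E z1 y1" "E z1 y2"
      using z sympD[OF G.sym] by blast+
    then have "nbrs E Y z1 = Y"
      unfolding Y(1) nbrs_def[of E "{y1, y2}"] by blast
    then show False
      using card_nbrs_in_Y[OF z(1)] card_Y by simp
  qed
  then have Z: "Z = {z1, z2}"
    using card_subset_eq[OF finite_Z, of "{z1, z2}"] z 2(2) by simp
  have ny: "\<not> E y1 y2"
    using has_non_nbr[of y1] Y by auto
  obtain z' where "z' \<in> Z" "z' \<noteq> z1" "\<not> co E z1 z'"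
    using doubly_critical.has_non_nbr[OF dual z(1)] by blast
  then have ez: "E z1 z2"
    using Z by (auto simp: co_def)
  have "z2 \<notin> nbrs E Z y1" "z1 \<notin> nbrs E Z y2"
    unfolding z1 z2 using \<open>z1 \<noteq> z2\<close> by auto
  then have nz: "\<not> E y1 z2" "\<not> E y2 z1"
    using z(1,2) by (simp_all add: nbrs_def[of E Z])
  have "y1 \<in> Y" "y2 \<in> Y"
    using Y by auto
  then have eu: "E u y1" "E u y2" "\<not> E u z1" "\<not> E u z2"
    using z by (auto simp: nbrs_def co_def)
  have "insert u (Y \<union> Z) = {u, y1, z1, z2, y2}"
    unfolding Y(1) Z by blast
  then have S: "S = {u, y1, z1, z2, y2}"
    by (simp only: S_eq[symmetric])
  have dist: "distinct [u, y1, z1, z2, y2]"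
    using disjoint Y(2) \<open>z1 \<noteq> z2\<close> unfolding Y(1) Z by auto
  let ?f = "\<lambda>i. [u, y1, z1, z2, y2] ! i"
  have five: "{..<5} = {0, 1, 2, 3, 4::nat}"
    by auto
  have "bij_betw ?f {..<5} S"
    using dist S by (auto simp: bij_betw_def five inj_on_def)
  moreover have "E a a = False" "E a b = E b a" for a b
    using G.irrefl G.sym by (auto simp: irreflp_def symp_def)
  then have "\<forall>i\<in>{..<5}. \<forall>j\<in>{..<5}. E (?f i) (?f j) \<longleftrightarrow> j = Suc i mod 5 \<or> i = Suc j mod 5"
    unfolding five using eu ez nz ny z by simp
  ultimately show ?thesis
    unfolding five_cycle_on_def by (metis lessThan_iff)
qed

end

section \<open>Regular extremal graphs\<close>

text \<open>
  Deleting \<open>u\<close> lowers both the chromatic number and the degrees of the neighbours of \<open>u\<close> by one, so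
  the neighbours form the middle level of \<open>S - {u}\<close> and the other vertices its high level.  A vertex
  \<open>w\<close> of the high level would be joined to all of \<open>S - {u}\<close>; by regularity it would be the only one,
  and then \<open>u\<close> and \<open>w\<close> could share a colour.
\<close>

lemma clique_if_critical_vertex:
  assumes "finite S" "symp E" "irreflp E"
    and reg: "\<And>v. v \<in> S \<Longrightarrow> card (nbrs E S v) + 1 = chi E S"
    and u: "u \<in> S" and NG: "NG E (S - {u})" and crit: "chi E (S - {u}) + 1 = chi E S"
  shows "\<forall>v\<in>S. \<forall>w\<in>S. v \<noteq> w \<longrightarrow> E v w"
proof -
  let ?T = "S - {u}"
  have fin: "finite ?T"
    using assms(1) by simp
  have adj: "card (nbrs E ?T v) + 2 = chi E S" if "v \<in> ?T" "E u v" for v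
  proof -
    have "nbrs E S v = insert u (nbrs E ?T v)" "u \<notin> nbrs E ?T v"
      using that u assms(2) by (auto simp: nbrs_def symp_def)
    then show ?thesis
      using reg[of v] that fin by simp
  qed
  have nonadj: "card (nbrs E ?T v) + 1 = chi E S" if "v \<in> ?T" "\<not> E u v" for v
  proof -
    have "nbrs E S v = nbrs E ?T v"
      using that u assms(2) by (auto simp: nbrs_def symp_def)
    then show ?thesis
      using reg[of v] that by simp
  qed
  have mid: "mid E ?T = nbrs E S u"
    using adj nonadj crit assms(3) by (fastforce simp: mid_def nbrs_def irreflp_def)
  have high: "high E ?T = {v \<in> ?T. \<not> E u v}"
    using adj nonadj crit by (fastforce simp: high_def)
  have "high E ?T = {}"
  proof (rule ccontr)
    assume "high E ?T \<noteq> {}"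
    then obtain w where w: "w \<in> high E ?T"
      by auto
    then have wS: "w \<in> S" "w \<noteq> u" "\<not> E u w"
      by (auto simp: high)
    have hf: "finite (high E ?T)"
      using fin by (simp add: high_def)
    note dec = NG_decomposition[OF fin assms(2,3) NG]
    have "E w v" if "v \<in> high E ?T" "v \<noteq> w" for v
      using clique_if_chi_eq_card[OF hf assms(3,2) dec(4) w that(1)] that(2) by auto
    moreover have "E w v" if "v \<in> nbrs E S u" for v
      using NG_mid_high_joined[OF fin assms(2,3) NG _ w, of v] that mid assms(2)
      by (auto simp: symp_def)
    ultimately have "nbrs E S u \<union> (high E ?T - {w}) \<subseteq> nbrs E S w"
      by (auto simp: nbrs_def high)
    moreover have "card (nbrs E S u) = card (nbrs E S w)"
      using reg[OF u] reg[OF wS(1)] by simp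
    moreover have "finite (nbrs E S w)"
      using assms(1) by simp
    ultimately have "nbrs E S u = nbrs E S w" "high E ?T - {w} \<subseteq> nbrs E S w"
      using card_subset_eq[of "nbrs E S w" "nbrs E S u"] by auto
    then have hw: "high E ?T = {w}"
      using w by (auto simp: high nbrs_def)
    then have "S - {u, w} = nbrs E S u"
      using high wS assms(3) by (auto simp: nbrs_def irreflp_def)
    then have "chi E S \<le> chi E (mid E ?T) + 1"
      using chi_Un_nonadjacent[OF assms(1,3,2) u wS(1,3)] mid by simp
    then show False
      using dec(3) hw crit by simp
  qed
  then have "nbrs E S u = ?T"
    using high assms(3) by (auto simp: nbrs_def irreflp_def)
  then have full: "card ?T + 1 = chi E S"
    using reg[OF u] by simp
  show ?thesis
  proof (intro ballI impI)
    fix v w assume vw: "v \<in> S" "w \<in> S" "v \<noteq> w"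
    have "nbrs E S v \<subseteq> S - {v}"
      using assms(3) by (auto simp: nbrs_def irreflp_def)
    moreover have "card (nbrs E S v) = card (S - {v})"
      using reg[OF vw(1)] full vw u assms(1) by simp
    ultimately have "nbrs E S v = S - {v}"
      using assms(1) by (intro card_subset_eq) auto
    then show "E v w"
      using vw by (auto simp: nbrs_def)
  qed
qed

lemma NG_regular:
  assumes "finite S" "symp E" "irreflp E" "NG E S" "S \<noteq> {}"
    and reg: "\<And>v. v \<in> S \<Longrightarrow> card (nbrs E S v) + 1 = chi E S"
  shows "(\<forall>v\<in>S. \<forall>w\<in>S. v \<noteq> w \<longrightarrow> E v w) \<or> (\<forall>v\<in>S. \<forall>w\<in>S. \<not> E v w) \<or> five_cycle_on E S"
proof -
  note co = symp_co[OF assms(2)] irreflp_co[of E]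
  obtain u where u: "u \<in> S"
    using assms(5) by auto
  let ?T = "S - {u}"
  have fin: "finite ?T" and card: "card ?T + 1 = card S"
    using assms(1) u card_Suc_Diff1[of S u] by auto
  have sum: "chi E S + chi (co E) S = card S + 1"
    using assms(4) by (simp add: NG_def)
  have co_reg: "card (nbrs (co E) S v) + 1 = chi (co E) S" if "v \<in> S" for v
    using card_nbrs_co[OF assms(1) that assms(3)] reg[OF that] sum by linarith
  have le: "chi E S \<le> chi E ?T + 1" "chi (co E) S \<le> chi (co E) ?T + 1"
    by (rule chi_remove[OF assms(1,3)], rule chi_remove[OF assms(1) co(2)])
  have mono: "chi E ?T \<le> chi E S" "chi (co E) ?T \<le> chi (co E) S"
    by (rule chi_mono[OF assms(1,3)], simp, rule chi_mono[OF assms(1) co(2)], simp)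
  have bound: "chi E ?T + chi (co E) ?T \<le> card S"
    using nordhaus_gaddum[OF fin assms(2,3)] card by simp
  consider (left) "chi E ?T + 1 = chi E S" "chi (co E) ?T = chi (co E) S"
    | (right) "chi E ?T = chi E S" "chi (co E) ?T + 1 = chi (co E) S"
    | (both) "chi E ?T + 1 = chi E S" "chi (co E) ?T + 1 = chi (co E) S"
    using le mono bound sum by linarith
  then show ?thesis
  proof cases
    case left
    then have "NG E ?T"
      using sum card by (simp add: NG_def)
    then show ?thesis
      using clique_if_critical_vertex[OF assms(1-3) reg u _ left(1)] by blast
  next
    case right
    then have "NG (co E) ?T"
      using sum card by (simp add: NG_def co_co[OF assms(3)])
    then have "\<forall>v\<in>S. \<forall>w\<in>S. v \<noteq> w \<longrightarrow> co E v w"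
      using clique_if_critical_vertex[OF assms(1) co co_reg u _ right(2)] by blast
    then have "\<forall>v\<in>S. \<forall>w\<in>S. \<not> E v w"
      using irreflpD[OF assms(3)] unfolding co_def by metis
    then show ?thesis by blast
  next
    case both
    obtain c where c: "colouring E ?T (chi E ?T) c"
      using chi_colouring[OF fin assms(3)] .
    obtain k where k: "colouring (co E) ?T (chi (co E) ?T) k"
      using chi_colouring[OF fin co(2)] .
    have "critical_regular E S (chi E ?T)"
    proof
      show "card (nbrs E S v) = chi E ?T" if "v \<in> S" for v
        using reg[OF that] both(1) by simp
    qed (use assms both in auto)
    moreover have "critical_regular (co E) S (chi (co E) ?T)"
    proof
      show "card (nbrs (co E) S v) = chi (co E) ?T" if "v \<in> S" for v
        using co_reg[OF that] both(2) by simp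
    qed (use assms(1) co both in auto)
    ultimately have "doubly_critical E S (chi E ?T) (chi (co E) ?T) u c k"
      using u c k by (simp add: doubly_critical_def)
    then show ?thesis
      by (intro disjI2 doubly_critical.edgeless_or_five_cycle)
  qed
qed

section \<open>Attaining the bound\<close>

text \<open>
  No vertex of \<open>T\<close> has the colour of \<open>w\<close>, so that colour can take the place of the last one.
\<close>

lemma chi_insert_dominating:
  assumes "finite T" "irreflp E" "symp E" "w \<notin> T" "\<forall>v\<in>T. E w v"
  shows "chi E T + 1 \<le> chi E (insert w T)"
proof -
  obtain c where c: "colouring E (insert w T) (chi E (insert w T)) c"
    using chi_colouring[of "insert w T" E] assms by auto
  define K where "K = chi E (insert w T) - 1"
  have K: "chi E (insert w T) = Suc K"
    using c by (auto simp: K_def colouring_def)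
  have "colouring E T K (\<lambda>v. if c v = K then c w else c v)"
    using c assms(5) unfolding K colouring_def
    by (auto simp: less_Suc_eq) metis+
  then show ?thesis
    using chi_le K by fastforce
qed

lemma chi_join_clique:
  assumes "finite C" "finite T" "irreflp E" "symp E" "C \<inter> T = {}"
    and "\<forall>u\<in>C. \<forall>v\<in>C. u \<noteq> v \<longrightarrow> E u v" "\<forall>u\<in>C. \<forall>v\<in>T. E u v"
  shows "chi E T + card C \<le> chi E (T \<union> C)"
  using assms(1,5-7)
proof (induction C rule: finite_induct)
  case (insert w C)
  then have "chi E (T \<union> C) + 1 \<le> chi E (insert w (T \<union> C))"
    by (intro chi_insert_dominating) (use assms(2-4) in auto)
  moreover have "chi E T + card C \<le> chi E (T \<union> C)"
    using insert by auto
  ultimately show ?case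
    using insert by simp
qed simp

text \<open>
  The degree is 2, and the complement, again a 5-cycle, is an odd cycle without a 2-colouring.
\<close>

lemma five_cycle_degree_sum:
  assumes "five_cycle_on E S" "irreflp E" "u \<in> S"
  shows "card S \<le> card (nbrs E S u) + chi (co E) S"
proof -
  obtain f where f: "bij_betw f {..<5::nat} S"
    and adj: "\<And>i j. i < 5 \<Longrightarrow> j < 5 \<Longrightarrow> E (f i) (f j) \<longleftrightarrow> j = Suc i mod 5 \<or> i = Suc j mod 5"
    using assms(1) by (auto simp: five_cycle_on_def)
  have fin: "finite S" and card: "card S = 5"
    using bij_betw_finite[OF f] bij_betw_same_card[OF f] by auto
  have inj: "f i = f j \<longleftrightarrow> i = j" if "i < 5" "j < 5" for i j
    using f that by (auto simp: bij_betw_def inj_on_def)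
  have mem: "f i \<in> S" if "i < 5" for i
    using f that by (auto simp: bij_betw_def)
  obtain i where i: "i < 5" "u = f i"
    using f assms(3) by (auto simp: bij_betw_def)
  let ?j = "Suc i mod 5" and ?l = "(i + 4) mod 5"
  have "i = Suc ?l mod 5" "?j \<noteq> ?l" "?j < 5" "?l < 5"
    using i(1) by presburger+
  then have "{f ?j, f ?l} \<subseteq> nbrs E S u" "card {f ?j, f ?l} = 2"
    using adj i mem inj by (auto simp: nbrs_def)
  then have "2 \<le> card (nbrs E S u)"
    using card_mono[of "nbrs E S u" "{f ?j, f ?l}"] fin by simp
  moreover have "3 \<le> chi (co E) S"
  proof (rule ccontr)
    assume "\<not> ?thesis"
    then have "chi (co E) S \<le> 2"
      by simp
    then obtain c where c: "colouring (co E) S 2 c"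
      using chi_le_colouring[OF fin irreflp_co] by metis
    (* The complement of the cycle is the odd cycle through 0, 2, 4, 1, 3. *)
    have two: "c (f i) < 2" if "i < 5" for i
      using c mem[OF that] by (simp add: colouring_def)
    have ne: "c (f i) \<noteq> c (f j)" if "i < 5" "j < 5" "i \<noteq> j" "j \<noteq> Suc i mod 5" "i \<noteq> Suc j mod 5" for i j
      using c mem that adj[OF that(1,2)] inj[OF that(1,2)] by (auto simp: colouring_def co_def)
    show False
      using two[of 0] two[of 1] two[of 2] two[of 3] two[of 4]
        ne[of 0 2] ne[of 2 4] ne[of 4 1] ne[of 1 3] ne[of 3 0] by simp
  qed
  ultimately show ?thesis
    using card by simp
qed

text \<open>
  The degree of a vertex \<open>u\<close> in the middle level fixes \<open>chi E S\<close>, and the low level is a clique of the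
  complement joined to the middle level.  In each of the three cases the degree of \<open>u\<close> inside the
  middle level and the complementary chromatic number of that level add up to at least its size.
\<close>

lemma NG_if_mid_structure:
  assumes "finite S" "symp E" "irreflp E" "mid E S \<noteq> {}"
    and "(\<forall>v\<in>mid E S. \<forall>w\<in>mid E S. v \<noteq> w \<longrightarrow> E v w) \<or>
         (\<forall>v\<in>mid E S. \<forall>w\<in>mid E S. \<not> E v w) \<or> five_cycle_on E (mid E S)"
    and "\<forall>v\<in>low E S. \<forall>w\<in>low E S. \<not> E v w"
    and "\<forall>u\<in>mid E S. \<forall>v\<in>high E S. E u v" "\<forall>u\<in>mid E S. \<forall>w\<in>low E S. \<not> E u w"
  shows "NG E S"
proof -
  note co = symp_co[OF assms(2)] irreflp_co[of E]
  let ?A = "mid E S" and ?B = "high E S" and ?C = "low E S"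
  have fin: "finite ?A" "finite ?B" "finite ?C"
    using assms(1) by (auto simp: mid_def high_def low_def)
  note part = mid_high_low_partition[where E = E and S = S]
  have card: "card S = card ?A + card ?B + card ?C"
    by (rule card_levels[OF assms(1)])
  obtain u where u: "u \<in> ?A"
    using assms(4) by auto
  have "nbrs E S u = nbrs E ?A u \<union> ?B"
    using part(1) assms(7,8) u unfolding nbrs_def by blast
  moreover have "nbrs E ?A u \<inter> ?B = {}"
    using part(2) nbrs_subset by fastforce
  ultimately have "card (nbrs E S u) = card (nbrs E ?A u) + card ?B"
    using fin by (simp add: card_Un_disjoint)
  then have chi: "chi E S = card (nbrs E ?A u) + card ?B + 1"
    using u by (simp add: mid_def)
  have "chi (co E) ?A + card ?C \<le> chi (co E) (?A \<union> ?C)"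
  proof (rule chi_join_clique[OF fin(3,1) co(2,1)])
    show "?C \<inter> ?A = {}"
      using part(3) by blast
    show "\<forall>u\<in>?C. \<forall>v\<in>?C. u \<noteq> v \<longrightarrow> co E u v"
      using assms(6) by (simp add: co_def)
    show "\<forall>u\<in>?C. \<forall>v\<in>?A. co E u v"
      using assms(8) sympD[OF assms(2)] part(3) unfolding co_def by blast
  qed
  moreover have "chi (co E) (?A \<union> ?C) \<le> chi (co E) S"
    using part(1) by (intro chi_mono[OF assms(1) co(2)]) blast
  moreover have "card ?A \<le> card (nbrs E ?A u) + chi (co E) ?A"
    using assms(5)
  proof (elim disjE)
    assume "\<forall>v\<in>?A. \<forall>w\<in>?A. v \<noteq> w \<longrightarrow> E v w"
    then have "?A - {u} \<subseteq> nbrs E ?A u"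
      using u by (auto simp: nbrs_def)
    then have "card (?A - {u}) \<le> card (nbrs E ?A u)"
      using fin by (intro card_mono) auto
    moreover have "0 < chi (co E) ?A"
      using chi_pos fin co assms(4) by blast
    ultimately show ?thesis
      using u fin by simp
  next
    assume "\<forall>v\<in>?A. \<forall>w\<in>?A. \<not> E v w"
    then have "chi (co E) {} + card ?A \<le> chi (co E) ({} \<union> ?A)"
      using fin co by (intro chi_join_clique) (auto simp: co_def)
    then show ?thesis by simp
  next
    assume "five_cycle_on E ?A"
    then show ?thesis
      using five_cycle_degree_sum assms(3) u by metis
  qed
  ultimately have "card S + 1 \<le> chi E S + chi (co E) S"
    using chi card by linarith
  then show ?thesis
    using nordhaus_gaddum[OF assms(1-3)] by (simp add: NG_def)
qed

theorem NG_characterisation: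
  assumes "finite S" "symp E" "irreflp E"
  shows "NG E S \<longleftrightarrow>
    (mid E S \<noteq> {} \<and>
      ((\<forall>v\<in>mid E S. \<forall>w\<in>mid E S. v \<noteq> w \<longrightarrow> E v w) \<or>
       (\<forall>v\<in>mid E S. \<forall>w\<in>mid E S. \<not> E v w) \<or> five_cycle_on E (mid E S))) \<and>
    (\<forall>v\<in>high E S. \<forall>w\<in>high E S. v \<noteq> w \<longrightarrow> E v w) \<and>
    (\<forall>v\<in>low E S. \<forall>w\<in>low E S. \<not> E v w) \<and>
    (\<forall>u\<in>mid E S. \<forall>v\<in>high E S. E u v) \<and>
    (\<forall>u\<in>mid E S. \<forall>w\<in>low E S. \<not> E u w)" (is "_ \<longleftrightarrow> ?R")
proof
  assume NG: "NG E S"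
  note co = symp_co[OF assms(2)] irreflp_co[of E]
  have fin: "finite (mid E S)" "finite (high E S)" "finite (low E S)"
    using assms(1) by (auto simp: mid_def high_def low_def)
  note dec = NG_decomposition[OF assms NG]
  have "\<forall>v\<in>high E S. \<forall>w\<in>high E S. v \<noteq> w \<longrightarrow> E v w"
    using clique_if_chi_eq_card[OF fin(2) assms(3,2) dec(4)] by blast
  moreover have "\<forall>v\<in>low E S. \<forall>w\<in>low E S. \<not> E v w"
    using clique_if_chi_eq_card[OF fin(3) co(2,1) dec(6)] irreflpD[OF assms(3)]
    unfolding co_def by metis
  moreover note NG_regular[OF fin(1) assms(2,3) dec(1,2) NG_mid_regular[OF assms NG]] dec(2)
    NG_mid_high_joined[OF assms NG] NG_mid_low_separated[OF assms NG]
  ultimately show ?R by blast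
next
  assume ?R
  then show "NG E S"
    by (intro NG_if_mid_structure[OF assms]) blast+
qed

section \<open>Back to graphs\<close>

definition adj :: "'a pair_pre_digraph \<Rightarrow> 'a \<Rightarrow> 'a \<Rightarrow> bool" where
  "adj G u v \<longleftrightarrow> (u, v) \<in> parcs G"

lemma symp_adj:
  assumes "pair_graph G"
  shows "symp (adj G)"
proof -
  interpret pair_graph G by (rule assms)
  show ?thesis
    using pair_sym_arcs by (auto simp: symp_def adj_def symmetric_def sym_def)
qed

lemma irreflp_adj:
  assumes "pair_graph G"
  shows "irreflp (adj G)"
proof -
  interpret pair_graph G by (rule assms)
  show ?thesis
    using pair_no_loops by (fastforce simp: irreflp_def adj_def)
qed

lemma chromatic_number_chi:
  assumes "pair_graph G"
  shows "chromatic_number G = chi (adj G) (pverts G)"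
proof -
  interpret pair_graph G by (rule assms)
  have "proper_colouring G k c \<longleftrightarrow> colouring (adj G) (pverts G) k c" for k c
    using wellformed' unfolding proper_colouring_def colouring_def adj_def by blast
  then show ?thesis
    by (simp add: chromatic_number_def chi_def)
qed

lemma chromatic_number_complement_chi:
  "chromatic_number (complement G) = chi (co (adj G)) (pverts G)"
proof -
  have "proper_colouring (complement G) k c \<longleftrightarrow> colouring (co (adj G)) (pverts G) k c" for k c
    by (auto simp: proper_colouring_def colouring_def complement_def co_def adj_def)
  then show ?thesis
    by (simp add: chromatic_number_def chi_def)
qed

lemma degree_card_nbrs:
  assumes "pair_graph G"
  shows "degree G v = card (nbrs (adj G) (pverts G) v)"
proof -
  interpret pair_graph G by (rule assms)
  have "out_arcs (with_proj G) v = Pair v ` nbrs (adj G) (pverts G) v"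
    using in_arcsD2 by (auto simp: nbrs_def adj_def)
  then show ?thesis
    by (simp add: degree_def out_degree_def card_image inj_on_def)
qed

lemma degree_classes:
  assumes "pair_graph G"
  shows "A_set G = mid (adj G) (pverts G)" "B_set G = high (adj G) (pverts G)"
    "C_set G = low (adj G) (pverts G)"
  by (auto simp: A_set_def B_set_def C_set_def mid_def high_def low_def
      degree_card_nbrs[OF assms] chromatic_number_chi[OF assms])

lemma complete_graph_induced:
  assumes "pair_graph G" "X \<subseteq> pverts G"
  shows "complete_graph (with_proj G \<restriction> X) \<longleftrightarrow> (\<forall>u\<in>X. \<forall>v\<in>X. u \<noteq> v \<longrightarrow> adj G u v)"
proof -
  interpret pair_graph G by (rule assms)
  let ?H = "\<lparr>pverts = X, parcs = {(u, v) \<in> parcs G. u \<in> X \<and> v \<in> X}\<rparr>"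
  have "with_proj G \<restriction> X = with_proj ?H"
    by (auto simp: induce_subgraph_def with_proj_def)
  moreover have "finite X"
    using assms(2) pair_finite_verts finite_subset by blast
  moreover have "u \<noteq> v" if "(u, v) \<in> parcs G" for u v
    using pair_no_loops[OF that] by simp
  then have "parcs ?H = {(u, v). (u, v) \<in> X \<times> X \<and> u \<noteq> v} \<longleftrightarrow>
      (\<forall>u\<in>X. \<forall>v\<in>X. u \<noteq> v \<longrightarrow> adj G u v)"
    by (auto simp: adj_def set_eq_iff)
  ultimately show ?thesis
    by (simp add: complete_graph_def complete_digraph_pair_def)
qed

lemma edgeless_graph_induced:
  "edgeless_graph (with_proj G \<restriction> X) \<longleftrightarrow> (\<forall>u\<in>X. \<forall>v\<in>X. \<not> adj G u v)"
  by (fastforce simp: edgeless_graph_def adj_def)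

lemma wf_cycle_graph: "wf_digraph (with_proj (cycle_graph n))"
  by unfold_locales (auto simp: cycle_graph_def)

lemma is_five_cycle_induced:
  "is_five_cycle (with_proj G \<restriction> X) \<longleftrightarrow> five_cycle_on (adj G) X"
proof
  assume "is_five_cycle (with_proj G \<restriction> X)"
  then obtain h where h: "pre_digraph.digraph_isomorphism (with_proj (cycle_graph 5)) h"
    and eq: "with_proj G \<restriction> X = app_iso h (with_proj (cycle_graph 5))"
    by (auto simp: is_five_cycle_def digraph_iso_def)
  let ?f = "iso_verts h"
  have inj: "inj_on ?f {..<5}"
    using h by (simp add: pre_digraph.digraph_isomorphism_def cycle_graph_def)
  have X: "X = ?f ` {..<5}"
    using arg_cong[OF eq, of verts] by (simp add: cycle_graph_def)
  have arcs: "{e \<in> parcs G. fst e \<in> X \<and> snd e \<in> X} = iso_arcs h ` parcs (cycle_graph 5)"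
    and tl: "iso_tail h = fst" and hd: "iso_head h = snd"
    using arg_cong[OF eq, of arcs] arg_cong[OF eq, of tail] arg_cong[OF eq, of head] by simp_all
  have image: "iso_arcs h e = (?f (fst e), ?f (snd e))" if "e \<in> parcs (cycle_graph 5)" for e
    using h that tl hd by (simp add: pre_digraph.digraph_isomorphism_def prod_eq_iff)
  have "adj G (?f i) (?f j) \<longleftrightarrow> j = Suc i mod 5 \<or> i = Suc j mod 5" if ij: "i < 5" "j < 5" for i j
  proof -
    have preimage: "e = (i, j)"
      if "e \<in> parcs (cycle_graph 5)" "?f (fst e) = ?f i" "?f (snd e) = ?f j" for e
    proof -
      have "fst e \<in> {..<5}" "snd e \<in> {..<5}"
        using that(1) by (auto simp: cycle_graph_def)
      then show ?thesis
        using inj_onD[OF inj that(2)] inj_onD[OF inj that(3)] ij by (simp add: prod_eq_iff)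
    qed
    have "adj G (?f i) (?f j) \<longleftrightarrow> (?f i, ?f j) \<in> {e \<in> parcs G. fst e \<in> X \<and> snd e \<in> X}"
      using ij X by (auto simp: adj_def)
    also have "\<dots> \<longleftrightarrow> (\<exists>e \<in> parcs (cycle_graph 5). (?f i, ?f j) = iso_arcs h e)"
      unfolding arcs image_iff ..
    also have "\<dots> \<longleftrightarrow> (\<exists>e \<in> parcs (cycle_graph 5). ?f (fst e) = ?f i \<and> ?f (snd e) = ?f j)"
      by (intro bex_cong refl) (auto simp: image)
    also have "\<dots> \<longleftrightarrow> (i, j) \<in> parcs (cycle_graph 5)"
      using preimage by (metis fst_conv snd_conv)
    also have "\<dots> \<longleftrightarrow> j = Suc i mod 5 \<or> i = Suc j mod 5"
      using ij by (simp add: cycle_graph_def)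
    finally show ?thesis .
  qed
  then show "five_cycle_on (adj G) X"
    using inj X by (auto simp: five_cycle_on_def bij_betw_def)
next
  assume "five_cycle_on (adj G) X"
  then obtain f where f: "bij_betw f {..<5::nat} X"
    and adj: "\<And>i j. i < 5 \<Longrightarrow> j < 5 \<Longrightarrow> adj G (f i) (f j) \<longleftrightarrow> j = Suc i mod 5 \<or> i = Suc j mod 5"
    by (auto simp: five_cycle_on_def)
  let ?C = "cycle_graph 5"
  let ?h = "\<lparr>iso_verts = f, iso_arcs = map_prod f f, iso_head = snd, iso_tail = fst\<rparr>"
  have inj: "inj_on f (pverts ?C)" and X: "X = f ` pverts ?C"
    using f by (auto simp: cycle_graph_def bij_betw_def)
  have sub: "parcs ?C \<subseteq> pverts ?C \<times> pverts ?C"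
    by (auto simp: cycle_graph_def)
  have "inj_on (map_prod f f) (parcs ?C)"
    using map_prod_inj_on[OF inj inj] sub inj_on_subset by blast
  then have "pre_digraph.digraph_isomorphism (with_proj ?C) ?h"
    using inj wf_cycle_graph by (simp add: pre_digraph.digraph_isomorphism_def)
  moreover have "{e \<in> parcs G. fst e \<in> X \<and> snd e \<in> X} = map_prod f f ` parcs ?C"
  proof (intro set_eqI iffI)
    fix e assume "e \<in> {e \<in> parcs G. fst e \<in> X \<and> snd e \<in> X}"
    then obtain i j where "i < 5" "j < 5" "e = (f i, f j)" "adj G (f i) (f j)"
      using X by (cases e) (auto simp: cycle_graph_def adj_def)
    then have "e = map_prod f f (i, j)" "(i, j) \<in> parcs ?C"
      using adj[of i j] by (auto simp: cycle_graph_def)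
    then show "e \<in> map_prod f f ` parcs ?C"
      by (rule image_eqI)
  next
    fix e assume "e \<in> map_prod f f ` parcs ?C"
    then obtain i j where e: "e = (f i, f j)" "(i, j) \<in> parcs ?C"
      by auto
    then have "i < 5" "j < 5" "adj G (f i) (f j)"
      using adj[of i j] by (auto simp: cycle_graph_def)
    then show "e \<in> {e \<in> parcs G. fst e \<in> X \<and> snd e \<in> X}"
      using e X by (auto simp: adj_def cycle_graph_def)
  qed
  then have "with_proj G \<restriction> X = app_iso ?h (with_proj ?C)"
    using X by (simp add: induce_subgraph_def app_iso_def)
  ultimately show "is_five_cycle (with_proj G \<restriction> X)"
    unfolding is_five_cycle_def digraph_iso_def by blast
qed

theorem theorem3p2:
  fixes G :: "'a pair_pre_digraph"
  assumes "pair_graph G"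
  shows "NG_graph G \<longleftrightarrow>
    (A_set G \<noteq> {} \<and>
      (complete_graph (with_proj G \<restriction> A_set G) \<or>
       edgeless_graph (with_proj G \<restriction> A_set G) \<or>
       is_five_cycle (with_proj G \<restriction> A_set G))) \<and>
    complete_graph (with_proj G \<restriction> B_set G) \<and>
    edgeless_graph (with_proj G \<restriction> C_set G) \<and>
    (\<forall>u \<in> A_set G. \<forall>v \<in> B_set G. (u, v) \<in> parcs G) \<and>
    (\<forall>u \<in> A_set G. \<forall>w \<in> C_set G. (u, w) \<notin> parcs G)"
proof -
  interpret pair_graph G by (rule assms)
  have "NG_graph G \<longleftrightarrow> NG (adj G) (pverts G)"
    by (simp add: NG_graph_def NG_def chromatic_number_chi[OF assms] chromatic_number_complement_chi)
  moreover have "A_set G \<subseteq> pverts G" "B_set G \<subseteq> pverts G"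
    by (auto simp: A_set_def B_set_def)
  ultimately show ?thesis
    unfolding NG_characterisation[OF pair_finite_verts symp_adj[OF assms] irreflp_adj[OF assms]]
      degree_classes[OF assms, symmetric]
    by (simp add: complete_graph_induced[OF assms] edgeless_graph_induced is_five_cycle_induced adj_def)
qed

end
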